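(* Let $\lambda$ be the uniform measure on $\{0,1\}^\omega$. For $\lambda$-almost every $\xi\in\{0,1\}^\omega$, the Schreier graph $\Gamma_\xi$ of the action of the Basilica group on the orbit of $\xi$ has one end. (Equivalently, almost every graph has one end with respect to the uniform measure on the set $\{(\Gamma_\xi,\xi) : \xi\in\{0,1\}^\omega\}$ of rooted orbital Schreier graphs.)
   Context: The Basilica group $B=\langle a,b\rangle$ acts on finite and infinite binary words by $a(0w)=0\,b(w)$, $a(1w)=1w$, $b(0w)=1\,a(w)$, $b(1w)=0w$. For $\xi\in\{0,1\}^\omega$, the Schreier graph $\Gamma_\xi$ is the undirected (unlabeled) multigraph with vertex set $B\cdot\xi$ and, for every vertex $x$ and $s\in\{a,b\}$, one edge joining $x$ and $s(x)$ (a loop if $s(x)=x$; parallel edges allowed). The uniform measure $\lambda$ is the product (Bernoulli $(1/2,1/2)$) Borel probability measure on $\{0,1\}^\omega$, giving each cylinder $w\{0,1\}^\omega$ measure $2^{-|w|}$. An end of an infinite graph is an equivalence class of rays, two rays being equivalent if for every finite vertex set $S$ both have a tail in the same component of the complement of $S$. *)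

theory Defs
  imports "HOL-Probability.Probability" "HOL-Algebra.Elementary_Groups" "HOL-Algebra.Bij"
    "HOL-Algebra.Group_Action"
begin

section \<open>The Basilica group\<close>

text \<open>
  Infinite binary words are \<open>bool stream\<close>s; the letter 0 is \<open>False\<close> and the letter 1 is \<open>True\<close>.
\<close>

type_synonym word = "bool stream"

datatype gen = Gen_a | Gen_b

text \<open>
  \<open>gen_act Gen_a\<close> and \<open>gen_act Gen_b\<close> are the maps \<open>a\<close> and \<open>b\<close>. Their mutual recursion is turned
  into a recursion over the index \<open>gen\<close>, because \<open>primcorec\<close> rejects two mutually recursive
  functions into the same codatatype. The usual recursion equations are \<open>gen_act_Stream\<close>.
\<close>

primcorec gen_act :: "gen \<Rightarrow> word \<Rightarrow> word" where
  "gen_act s w = (if s = Gen_a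
     then shd w ## (if shd w then stl w else gen_act Gen_b (stl w))
     else (\<not> shd w) ## (if shd w then stl w else gen_act Gen_a (stl w)))"

lemma gen_act_Stream:
  "gen_act Gen_a (False ## w) = False ## gen_act Gen_b w"
  "gen_act Gen_a (True ## w) = True ## w"
  "gen_act Gen_b (False ## w) = True ## gen_act Gen_a w"
  "gen_act Gen_b (True ## w) = False ## w"
  by (subst gen_act.code; simp)+

primcorec gen_act_inv :: "gen \<Rightarrow> word \<Rightarrow> word" where
  "gen_act_inv s w = (if s = Gen_a
     then shd w ## (if shd w then stl w else gen_act_inv Gen_b (stl w))
     else (\<not> shd w) ## (if shd w then gen_act_inv Gen_a (stl w) else stl w))"

lemma gen_act_inverse:
  "gen_act_inv s (gen_act s w) = w" "gen_act s (gen_act_inv s w) = w"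
proof -
  have "gen_act_inv s (gen_act s w) !! n = w !! n \<and> gen_act s (gen_act_inv s w) !! n = w !! n" for n
  proof (induction n arbitrary: s w)
    case 0
    show ?case by (cases s) simp_all
  next
    case (Suc n)
    then show ?case by (cases s) simp_all
  qed
  moreover have "u = v" if "\<And>n. u !! n = v !! n" for u v :: word
    using smap_alt[of id u v] that by (simp add: stream.map_id)
  ultimately show "gen_act_inv s (gen_act s w) = w" "gen_act s (gen_act_inv s w) = w"
    by blast+
qed

lemma bij_gen_act: "bij (gen_act s)"
  by (rule o_bij[of "gen_act_inv s"]) (auto simp: gen_act_inverse)

text \<open>
  The action of \<open>B\<close> on infinite words is faithful, so \<open>B\<close> is taken as the subgroup of the
  permutation group of the infinite words generated by \<open>a\<close> and \<open>b\<close>.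
\<close>

definition basilica :: "(word \<Rightarrow> word) monoid" where
  "basilica = subgroup_generated (BijGroup UNIV) {gen_act Gen_a, gen_act Gen_b}"

lemma gen_act_in_basilica: "gen_act s \<in> carrier basilica"
  unfolding basilica_def carrier_subgroup_generated
  by (cases s) (auto intro!: generate.incl simp: BijGroup_def Bij_def bij_gen_act)

section \<open>Undirected multigraphs and their ends\<close>

text \<open>
  An edge \<open>e\<close> joins the one (loop) or two elements of \<open>endpoints G e\<close>; distinct edges with the same
  endpoints are parallel.
\<close>

record ('v, 'e) multigraph =
  verts :: "'v set"
  edges :: "'e set"
  endpoints :: "'e \<Rightarrow> 'v set"

definition adjacent :: "('v, 'e) multigraph \<Rightarrow> 'v \<Rightarrow> 'v \<Rightarrow> bool" where
  "adjacent G x y \<longleftrightarrow> (\<exists>e\<in>edges G. endpoints G e = {x, y})"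

definition ray :: "('v, 'e) multigraph \<Rightarrow> (nat \<Rightarrow> 'v) \<Rightarrow> bool" where
  "ray G r \<longleftrightarrow> range r \<subseteq> verts G \<and> inj r \<and> (\<forall>n. adjacent G (r n) (r (Suc n)))"

definition components_minus :: "('v, 'e) multigraph \<Rightarrow> 'v set \<Rightarrow> 'v set set" where
  "components_minus G S =
    (\<lambda>x. {y. (\<lambda>u v. adjacent G u v \<and> u \<notin> S \<and> v \<notin> S)\<^sup>*\<^sup>* x y}) ` (verts G - S)"

definition ray_equiv :: "('v, 'e) multigraph \<Rightarrow> ((nat \<Rightarrow> 'v) \<times> (nat \<Rightarrow> 'v)) set" where
  "ray_equiv G = {(r, r'). ray G r \<and> ray G r' \<and>
     (\<forall>S. finite S \<and> S \<subseteq> verts G \<longrightarrow>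
       (\<exists>C\<in>components_minus G S. (\<exists>m. \<forall>n\<ge>m. r n \<in> C) \<and> (\<exists>m. \<forall>n\<ge>m. r' n \<in> C)))}"

definition graph_ends :: "('v, 'e) multigraph \<Rightarrow> (nat \<Rightarrow> 'v) set set" where
  "graph_ends G = Collect (ray G) // ray_equiv G"

definition one_ended :: "('v, 'e) multigraph \<Rightarrow> bool" where
  "one_ended G \<longleftrightarrow> card (graph_ends G) = 1"

section \<open>Schreier graphs and the uniform measure\<close>

definition schreier_graph :: "word \<Rightarrow> (word, word \<times> gen) multigraph" where
  "schreier_graph \<xi> =
    \<lparr>verts = orbit basilica (\<lambda>g. g) \<xi>,
     edges = orbit basilica (\<lambda>g. g) \<xi> \<times> UNIV,
     endpoints = (\<lambda>(x, s). {x, gen_act s x})\<rparr>"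

definition uniform_measure_words :: "word measure" where
  "uniform_measure_words = stream_space (measure_pmf (bernoulli_pmf (1/2)))"

lemma emeasure_cylinder:
  "emeasure uniform_measure_words {\<xi>. stake (length u) \<xi> = u} = ennreal ((1/2) ^ length u)"
proof (induction u)
  case Nil
  interpret prob_space uniform_measure_words
    unfolding uniform_measure_words_def
    by (rule prob_space.prob_space_stream_space) (rule prob_space_measure_pmf)
  have "space uniform_measure_words = UNIV"
    by (simp add: uniform_measure_words_def space_stream_space)
  then show ?case using emeasure_space_1 by simp
next
  case (Cons x u)
  let ?p = "measure_pmf (bernoulli_pmf (1/2))"
  have sets: "{\<xi>. stake (length v) \<xi> = v} \<in> sets (stream_space ?p)" for v :: "bool list"
  proof -
    have "Measurable.pred (stream_space ?p) (\<lambda>\<xi>. stake (length v) \<xi> = v)"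
      by measurable
    then show ?thesis by (simp add: pred_def space_stream_space)
  qed
  have "emeasure (stream_space ?p) {\<xi>. stake (length (x # u)) \<xi> = x # u} =
      (\<integral>\<^sup>+t. indicator {x} t * emeasure (stream_space ?p) {\<xi>. stake (length u) \<xi> = u} \<partial>?p)"
    by (subst prob_space.emeasure_stream_space[OF prob_space_measure_pmf sets])
      (auto intro!: nn_integral_cong simp: space_stream_space indicator_def)
  also have "\<dots> = emeasure ?p {x} * ennreal ((1/2) ^ length u)"
    using Cons.IH by (simp add: uniform_measure_words_def nn_integral_multc)
  also have "emeasure ?p {x} = ennreal (1/2)"
    by (cases x) (simp_all add: emeasure_pmf_single)
  also have "ennreal (1/2) * ennreal ((1/2) ^ length u) = ennreal ((1/2) ^ length (x # u))"
    by (subst ennreal_mult[symmetric]) simp_all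
  finally show ?case
    by (simp only: uniform_measure_words_def)
qed

text \<open>
  The uniform measure on the set of all pairs \<open>(\<Gamma>\<^sub>\<xi>, \<xi>)\<close> is the measure transported from the
  words along the injection \<open>\<xi> \<mapsto> (\<Gamma>\<^sub>\<xi>, \<xi>)\<close>.
\<close>

definition uniform_measure_rooted :: "((word, word \<times> gen) multigraph \<times> word) measure" where
  "uniform_measure_rooted = embed_measure uniform_measure_words (\<lambda>\<xi>. (schreier_graph \<xi>, \<xi>))"

end

theory Submission
  imports Defs
begin

text \<open>
  Group the vertices of a Schreier graph into \<^emph>\<open>tiles\<close>: the tile of level \<open>n\<close> with tail \<open>\<zeta>\<close> consists
  of the \<open>2\<^sup>n\<close> words \<open>u\<zeta>\<close> with \<open>|u| = n\<close>. Reading a letter, a generator either hands the other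
  generator on to the rest of the word or leaves the rest alone. So a generator acts on the tail
  of a word as \<open>a\<close>, as \<open>b\<close> or not at all, and a path that leaves the tile with tail \<open>\<zeta>\<close> continues in
  a tile whose tail is \<open>s\<zeta>\<close> for some \<open>s \<in> {a, b, a\<^sup>-\<^sup>1, b\<^sup>-\<^sup>1}\<close>.

  If \<open>\<zeta> = 11\<zeta>'\<close>, then \<open>a\<close> fixes \<open>\<zeta>\<close>, and both \<open>b\<close> and \<open>b\<^sup>-\<^sup>1\<close> send it to \<open>01\<zeta>'\<close>. The tile with tail
  \<open>\<zeta>\<close> therefore has a single neighbouring tile (\<open>tile_11_exit\<close>). Tiles are connected, because the two
  halves of a tile of level \<open>n + 1\<close> are joined by an edge (\<open>tile_connected\<close>). Hence any path
  that enters and leaves the tile with tail \<open>\<zeta>\<close> can be rerouted through its neighbour, and removing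
  the tile leaves the graph connected (\<open>tile_11_complement_connected\<close>).

  A random word \<open>\<xi>\<close> almost surely contains the block 11 infinitely often (\<open>AE_recurrent_11\<close>). For
  such \<open>\<xi>\<close> every point of the orbit has a tail in common with \<open>\<xi>\<close> (\<open>orbit_cofinal\<close>), so the tiles of
  \<open>\<xi>\<close> at the positions of the block 11 are finite sets that exhaust the graph and have connected
  complement. Every ray eventually stays in such a complement, and this makes any two rays
  equivalent (\<open>one_endedI\<close>). A ray exists by Koenig's lemma (\<open>exists_ray\<close>). The second claim is the
  first one transported along the injection that defines the measure on rooted graphs.
\<close>

section \<open>Rays and one-endedness\<close>

text \<open>
  Koenig's lemma for an infinite, connected, locally finite graph.
\<close>

lemma exists_ray:
  assumes inf: "infinite (verts G)" and x0: "x\<^sub>0 \<in> verts G"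
    and closed: "\<And>x y. x \<in> verts G \<Longrightarrow> adjacent G x y \<Longrightarrow> y \<in> verts G"
    and conn: "\<And>y. y \<in> verts G \<Longrightarrow> (adjacent G)\<^sup>*\<^sup>* x\<^sub>0 y"
    and fin: "\<And>x. x \<in> verts G \<Longrightarrow> finite {y. adjacent G x y}"
  shows "\<exists>r. ray G r"
proof -
  \<comment> \<open>Grow the ray inside the directed graph \<open>E\<close> of edges that increase the distance \<open>d\<close> from \<open>x\<^sub>0\<close>:
    there the distance makes every infinite path injective.\<close>
  define d where "d y = (LEAST n. (adjacent G ^^ n) x\<^sub>0 y)" for y
  define E where "E x y \<longleftrightarrow> x \<in> verts G \<and> adjacent G x y \<and> d y = Suc (d x)" for x y
  have d_path: "(adjacent G ^^ d y) x\<^sub>0 y" if "y \<in> verts G" for y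
    unfolding d_def using conn[OF that] by (metis LeastI rtranclp_imp_relpowp)
  have verts_path: "y \<in> verts G" if "(adjacent G ^^ n) x\<^sub>0 y" for n y
    using that by (induction n arbitrary: y) (auto simp: x0 intro: closed)
  have desc: "E\<^sup>*\<^sup>* x\<^sub>0 y" if "y \<in> verts G" for y
    using that
  proof (induction "d y" arbitrary: y)
    case 0
    then show ?case using d_path[of y] by simp
  next
    case (Suc n)
    from d_path[OF Suc.prems] obtain z where z: "(adjacent G ^^ n) x\<^sub>0 z" "adjacent G z y"
      using Suc(2) by (metis relpowp_Suc_E)
    have zV: "z \<in> verts G" using verts_path z by blast
    have "d z \<le> n" unfolding d_def using z(1) by (rule Least_le)
    moreover have "(adjacent G ^^ Suc (d z)) x\<^sub>0 y"
      using d_path[OF zV] z(2) by auto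
    then have "Suc n \<le> Suc (d z)" using Suc(2) unfolding d_def by (metis Least_le)
    ultimately have "d z = n" by simp
    then have "E z y" using zV z(2) Suc(2) by (simp add: E_def)
    then show ?case using Suc(1)[of z] zV \<open>d z = n\<close> by (metis rtranclp.rtrancl_into_rtrancl)
  qed
  \<comment> \<open>A vertex with infinitely many descendants has a successor with infinitely many, since its
    successors are finite in number.\<close>
  have "\<exists>r. \<forall>n. (r n \<in> verts G \<and> infinite {y. E\<^sup>*\<^sup>* (r n) y}) \<and> E (r n) (r (Suc n))"
  proof (rule dependent_nat_choice)
    show "\<exists>x. x \<in> verts G \<and> infinite {y. E\<^sup>*\<^sup>* x y}"
      using x0 inf desc finite_subset[of "verts G" "{y. E\<^sup>*\<^sup>* x\<^sub>0 y}"] by blast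
  next
    fix x n
    assume x: "x \<in> verts G \<and> infinite {y. E\<^sup>*\<^sup>* x y}"
    have "{y. E\<^sup>*\<^sup>* x y} \<subseteq> {x} \<union> (\<Union>z\<in>{z. E x z}. {y. E\<^sup>*\<^sup>* z y})"
      by (auto elim: converse_rtranclpE)
    moreover have "finite {z. E x z}"
      using x by (auto simp: E_def intro: finite_subset[OF _ fin])
    ultimately obtain z where "E x z" "infinite {y. E\<^sup>*\<^sup>* z y}"
      using x by (metis (no_types, lifting) finite.emptyI finite.insertI finite_UN finite_Un
          finite_subset mem_Collect_eq)
    then show "\<exists>z. (z \<in> verts G \<and> infinite {y. E\<^sup>*\<^sup>* z y}) \<and> E x z"
      using closed by (auto simp: E_def)
  qed
  then obtain r where r: "\<And>n. r n \<in> verts G" "\<And>n. E (r n) (r (Suc n))" by blast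
  have dr: "d (r n) = d (r 0) + n" for n
    by (induction n) (use r(2) in \<open>auto simp: E_def\<close>)
  have "inj r" by (rule injI) (metis dr add_left_cancel)
  then have "ray G r" using r by (auto simp: ray_def E_def)
  then show ?thesis by blast
qed

text \<open>
  A ray is injective, so it has a tail outside the finite set \<open>F\<close>; there any two rays are joined
  without meeting \<open>F\<close>, hence without meeting \<open>S\<close>.
\<close>

lemma one_endedI:
  assumes ray: "\<exists>r. ray G r"
    and exh: "\<And>S. finite S \<Longrightarrow> S \<subseteq> verts G \<Longrightarrow> \<exists>F. finite F \<and> S \<subseteq> F \<and>
      (\<forall>x\<in>verts G - F. \<forall>y\<in>verts G - F. (\<lambda>u v. adjacent G u v \<and> u \<notin> F \<and> v \<notin> F)\<^sup>*\<^sup>* x y)"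
  shows "one_ended G"
proof -
  have equiv: "(r, r') \<in> ray_equiv G" if r: "ray G r" "ray G r'" for r r'
    unfolding ray_equiv_def
  proof (clarsimp simp: r)
    fix S assume "finite S" "S \<subseteq> verts G"
    from exh[OF this] obtain F where F: "finite F" "S \<subseteq> F"
      and conn: "\<And>x y. x \<in> verts G - F \<Longrightarrow> y \<in> verts G - F \<Longrightarrow>
        (\<lambda>u v. adjacent G u v \<and> u \<notin> F \<and> v \<notin> F)\<^sup>*\<^sup>* x y" by blast
    have leave: "\<exists>m. \<forall>n\<ge>m. q n \<in> verts G - F" if "ray G q" for q
    proof -
      have "finite (q -` F)" using F that by (auto simp: ray_def intro: finite_vimageI)
      then obtain m where "\<forall>n\<in>q -` F. n < m" using finite_nat_set_iff_bounded by blast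
      then have "q n \<notin> F" if "n \<ge> m" for n using that by (meson linorder_not_le vimageI)
      moreover have "q n \<in> verts G" for n using \<open>ray G q\<close> by (auto simp: ray_def)
      ultimately show ?thesis by blast
    qed
    obtain m m' where m: "\<And>n. n \<ge> m \<Longrightarrow> r n \<in> verts G - F"
      and m': "\<And>n. n \<ge> m' \<Longrightarrow> r' n \<in> verts G - F"
      using leave r by metis
    let ?R = "\<lambda>u v. adjacent G u v \<and> u \<notin> S \<and> v \<notin> S"
    let ?C = "{y. ?R\<^sup>*\<^sup>* (r m) y}"
    have C: "y \<in> ?C" if "y \<in> verts G - F" for y
      using rtranclp_mono[THEN predicate2D, OF _ conn[OF m[OF order.refl] that], of ?R] F(2) by blast
    have "?C \<in> components_minus G S"
      using m[of m] F(2) by (auto simp: components_minus_def)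
    then show "\<exists>C\<in>components_minus G S. (\<exists>m. \<forall>n\<ge>m. r n \<in> C) \<and> (\<exists>m. \<forall>n\<ge>m. r' n \<in> C)"
      using C m m' by blast
  qed
  then have "ray_equiv G = Collect (ray G) \<times> Collect (ray G)"
    by (auto simp: ray_equiv_def)
  then have "graph_ends G = {Collect (ray G)}"
    using ray by (auto simp: graph_ends_def quotient_def)
  then show ?thesis by (simp add: one_ended_def)
qed

section \<open>Adjacency in the Schreier graphs\<close>

text \<open>
  The adjacency relation of all Schreier graphs at once; each \<open>\<Gamma>\<^sub>\<xi>\<close> is one of its components. Paths
  can thus be built without keeping track of the orbit.
\<close>

definition gen_adj :: "word \<Rightarrow> word \<Rightarrow> bool" where
  "gen_adj x y \<longleftrightarrow> (\<exists>s. y = gen_act s x \<or> x = gen_act s y)"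

lemma gen_adj_sym: "gen_adj x y \<Longrightarrow> gen_adj y x"
  by (auto simp: gen_adj_def)

lemma gen_act_in_Bij: "gen_act s \<in> Bij UNIV"
  by (simp add: Bij_def bij_gen_act)

lemma inv_gen_act: "inv\<^bsub>BijGroup UNIV\<^esub> gen_act s = gen_act_inv s"
proof -
  have "inv_into UNIV (gen_act s) = gen_act_inv s"
    by (rule inv_unique_comp) (auto simp: gen_act_inverse)
  then show ?thesis
    by (simp add: inv_BijGroup gen_act_in_Bij restrict_UNIV)
qed

text \<open>
  A product of generators and their inverses applied to \<open>\<xi>\<close> is a path from \<open>\<xi>\<close>, and conversely; edges
  traversed backwards account for the inverses.
\<close>

lemma orbit_basilica: "orbit basilica (\<lambda>g. g) \<xi> = {\<eta>. gen_adj\<^sup>*\<^sup>* \<xi> \<eta>}"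
proof -
  let ?gens = "{gen_act Gen_a, gen_act Gen_b}"
  have carrier: "carrier basilica = generate (BijGroup UNIV) ?gens"
    unfolding basilica_def carrier_subgroup_generated
    by (intro arg_cong2[where f = generate]) (auto simp: BijGroup_def gen_act_in_Bij)
  have "carrier basilica \<subseteq> carrier (BijGroup UNIV)"
    unfolding basilica_def by (rule group.carrier_subgroup_generated_subset[OF group_BijGroup])
  then have mult: "(h \<otimes>\<^bsub>BijGroup UNIV\<^esub> g) x = h (g x)"
    if "h \<in> carrier basilica" "g \<in> carrier basilica" for g h x
    using that by (auto simp: BijGroup_def compose_def)
  have gen: "gen_act s \<in> ?gens" for s by (cases s) auto
  have path: "gen_adj\<^sup>*\<^sup>* x (g x)" if "g \<in> generate (BijGroup UNIV) ?gens" for g x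
    using that
  proof (induction arbitrary: x)
    case one
    then show ?case by (simp add: BijGroup_def)
  next
    case (incl h)
    then have "gen_adj x (h x)" by (auto simp: gen_adj_def)
    then show ?case by blast
  next
    case (inv h)
    then obtain s where "h = gen_act s" by auto
    moreover have "gen_adj x (gen_act_inv s x)"
      unfolding gen_adj_def by (metis gen_act_inverse(2))
    ultimately show ?case by (auto simp: inv_gen_act)
  next
    case (eng h1 h2)
    then show ?case
      by (metis carrier mult rtranclp_trans)
  qed
  have closed: "\<exists>g\<in>carrier basilica. \<eta> = g \<xi>" if "gen_adj\<^sup>*\<^sup>* \<xi> \<eta>" for \<eta>
    using that
  proof (induction rule: rtranclp_induct)
    case base
    have "\<one>\<^bsub>BijGroup UNIV\<^esub> \<in> carrier basilica"
      unfolding carrier by (rule generate.one)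
    then show ?case by (intro bexI[where x = "\<one>\<^bsub>BijGroup UNIV\<^esub>"]) (simp_all add: BijGroup_def)
  next
    case (step y z)
    then obtain g where g: "g \<in> carrier basilica" "y = g \<xi>" by blast
    from step(2) obtain s where "z = gen_act s y \<or> z = gen_act_inv s y"
      unfolding gen_adj_def by (metis gen_act_inverse(1))
    moreover have "gen_act s \<in> carrier basilica" "gen_act_inv s \<in> carrier basilica"
      unfolding carrier
      using generate.incl[OF gen] generate.inv[OF gen, of "BijGroup UNIV" s]
      by (simp_all add: inv_gen_act)
    ultimately obtain h where h: "h \<in> carrier basilica" "z = h y" by blast
    have "h \<otimes>\<^bsub>BijGroup UNIV\<^esub> g \<in> carrier basilica"
      using h(1) g(1) unfolding carrier by (rule generate.eng)
    then show ?case using mult[OF h(1) g(1)] h(2) g(2) by metis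
  qed
  show ?thesis
    using path closed unfolding orbit_def carrier by blast
qed

lemma adjacent_schreier_graph:
  assumes "x \<in> verts (schreier_graph \<xi>)"
  shows "adjacent (schreier_graph \<xi>) x y \<longleftrightarrow> gen_adj x y"
proof
  assume "gen_adj x y"
  moreover from this have "y \<in> verts (schreier_graph \<xi>)"
    using assms by (auto simp: schreier_graph_def orbit_basilica)
  ultimately show "adjacent (schreier_graph \<xi>) x y"
    using assms by (fastforce simp: adjacent_def schreier_graph_def gen_adj_def doubleton_eq_iff)
next
  assume "adjacent (schreier_graph \<xi>) x y"
  then show "gen_adj x y"
    by (auto simp: adjacent_def schreier_graph_def gen_adj_def doubleton_eq_iff)
qed

lemma finite_gen_adj: "finite {y. gen_adj x y}"
proof (rule finite_subset)
  show "{y. gen_adj x y} \<subseteq> (\<lambda>s. gen_act s x) ` {Gen_a, Gen_b} \<union> (\<lambda>s. gen_act_inv s x) ` {Gen_a, Gen_b}"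
  proof
    fix y assume "y \<in> {y. gen_adj x y}"
    then obtain s where "y = gen_act s x \<or> y = gen_act_inv s x"
      unfolding gen_adj_def mem_Collect_eq by (metis gen_act_inverse(1))
    then show "y \<in> (\<lambda>s. gen_act s x) ` {Gen_a, Gen_b} \<union> (\<lambda>s. gen_act_inv s x) ` {Gen_a, Gen_b}"
      by (cases s) auto
  qed
qed auto

section \<open>Tiles\<close>

text \<open>
  The tile of level \<open>n\<close> with tail \<open>\<zeta>\<close> is \<open>{\<eta>. sdrop n \<eta> = \<zeta>}\<close>. Passing from a tail to the next one is
  stated without \<^const>\<open>stl\<close>, which the rewriting rules for \<^const>\<open>sdrop\<close> move in opposite directions.
\<close>

lemma sdrop_unfold: "sdrop n x = x !! n ## sdrop (Suc n) x"
  by (rule stream.expand) (simp only: stream.sel sdrop_simps simp_thms)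

lemma sdrop_Suc_eq: "sdrop n x = c ## \<zeta> \<Longrightarrow> sdrop (Suc n) x = \<zeta>"
  using sdrop_unfold[of n x] by (simp only: stream.inject)

lemma sdrop_eq_mono:
  assumes "sdrop m x = sdrop m y" "m \<le> n"
  shows "sdrop n x = sdrop n y"
proof -
  have "sdrop n z = sdrop (n - m) (sdrop m z)" for z :: "'a stream"
    using assms(2) by (simp add: sdrop_add)
  then have "sdrop n x = sdrop (n - m) (sdrop m x)" "sdrop n y = sdrop (n - m) (sdrop m y)"
    by blast+
  with assms(1) show ?thesis by metis
qed

lemma finite_tile: "finite {\<eta> :: word. sdrop n \<eta> = \<zeta>}"
proof (rule finite_subset)
  show "{\<eta> :: word. sdrop n \<eta> = \<zeta>} \<subseteq> (\<lambda>u. u @- \<zeta>) ` {u. set u \<subseteq> UNIV \<and> length u = n}"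
  proof
    fix \<eta> :: word assume "\<eta> \<in> {\<eta>. sdrop n \<eta> = \<zeta>}"
    then have "\<eta> = stake n \<eta> @- \<zeta>" by (metis mem_Collect_eq stake_sdrop)
    then show "\<eta> \<in> (\<lambda>u. u @- \<zeta>) ` {u. set u \<subseteq> UNIV \<and> length u = n}"
      by (rule image_eqI) simp
  qed
  show "finite ((\<lambda>u. u @- \<zeta>) ` {u :: bool list. set u \<subseteq> UNIV \<and> length u = n})"
    by (intro finite_imageI finite_lists_length_eq) simp
qed

text \<open>
  After each letter a generator continues as a generator or stops acting.
\<close>

lemma sdrop_gen_act:
  "sdrop n (gen_act s x) = sdrop n x \<or> (\<exists>t. sdrop n (gen_act s x) = gen_act t (sdrop n x))"
proof (induction n arbitrary: s x)
  case 0
  show ?case by auto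
next
  case (Suc n)
  then show ?case by (cases s) auto
qed

text \<open>
  Reading the letter 0 hands \<open>b\<close> on from \<open>a\<close>, and \<open>a\<close> from \<open>b\<close>. So exactly one generator applied to
  the word \<open>0\<^sup>n\<zeta>\<close> reaches the tail as \<open>t\<close>, and it gives an edge from the tile of \<open>\<zeta>\<close> to that of \<open>t\<zeta>\<close>.
\<close>

lemma gen_act_between_tiles:
  "\<exists>s x. sdrop n x = \<zeta> \<and> sdrop n (gen_act s x) = gen_act t \<zeta>"
proof (induction n)
  case 0
  show ?case by auto
next
  case (Suc n)
  then obtain s x where sx: "sdrop n x = \<zeta>" "sdrop n (gen_act s x) = gen_act t \<zeta>" by blast
  show ?case
    using sx gen_act_Stream(1,3)[of x] by (cases s) (metis sdrop.simps(2) stream.sel(2))+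
qed

text \<open>
  A tile of level \<open>n + 1\<close> is the union of two tiles of level \<open>n\<close>, which are joined by an edge.
\<close>

lemma tile_connected:
  assumes "sdrop n x = \<zeta>" "sdrop n y = \<zeta>"
  shows "(\<lambda>u v. gen_adj u v \<and> sdrop n u = \<zeta> \<and> sdrop n v = \<zeta>)\<^sup>*\<^sup>* x y"
  using assms
proof (induction n arbitrary: \<zeta> x y)
  case 0
  then show ?case by simp
next
  case (Suc n)
  let ?R = "\<lambda>u v. gen_adj u v \<and> sdrop (Suc n) u = \<zeta> \<and> sdrop (Suc n) v = \<zeta>"
  have half: "?R\<^sup>*\<^sup>* u v" if "sdrop n u = c ## \<zeta>" "sdrop n v = c ## \<zeta>" for u v c
    by (rule rtranclp_mono[THEN predicate2D, OF _ Suc.IH[OF that]])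
      (auto simp del: sdrop.simps dest: sdrop_Suc_eq)
  \<comment> \<open>The halves have tails \<open>1\<zeta>\<close> and \<open>0\<zeta> = b(1\<zeta>)\<close>.\<close>
  obtain s p where p: "sdrop n p = True ## \<zeta>" "sdrop n (gen_act s p) = False ## \<zeta>"
    using gen_act_between_tiles[of n "True ## \<zeta>" Gen_b] by (auto simp: gen_act_Stream)
  then have edge: "?R p (gen_act s p)" "?R (gen_act s p) p"
    by (auto simp: gen_adj_def simp del: sdrop.simps dest: sdrop_Suc_eq)
  have split: "sdrop n w = True ## \<zeta> \<or> sdrop n w = False ## \<zeta>" if "sdrop (Suc n) w = \<zeta>" for w
    using sdrop_unfold[of n w] that by (cases "w !! n") (simp_all only: simp_thms)
  show ?case
  proof (rule disjE[OF split[OF Suc.prems(1)]]; rule disjE[OF split[OF Suc.prems(2)]])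
    assume "sdrop n x = True ## \<zeta>" "sdrop n y = True ## \<zeta>"
    then show ?thesis by (rule half)
  next
    assume x: "sdrop n x = True ## \<zeta>" and y: "sdrop n y = False ## \<zeta>"
    show ?thesis
      by (rule rtranclp_trans[OF rtranclp.rtrancl_into_rtrancl[OF half[OF x p(1)] edge(1)] half[OF p(2) y]])
  next
    assume x: "sdrop n x = False ## \<zeta>" and y: "sdrop n y = True ## \<zeta>"
    show ?thesis
      by (rule rtranclp_trans[OF rtranclp.rtrancl_into_rtrancl[OF half[OF x p(2)] edge(2)] half[OF p(1) y]])
  next
    assume "sdrop n x = False ## \<zeta>" "sdrop n y = False ## \<zeta>"
    then show ?thesis by (rule half)
  qed
qed

section \<open>Tiles whose tail begins with 11\<close>

text \<open>
  On a word beginning with 11 the generator \<open>a\<close> and its inverse act trivially, while \<open>b\<close> and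
  \<open>b\<^sup>-\<^sup>1\<close> agree: each of them only turns the first letter into 0, because \<open>a\<^sup>-\<^sup>1\<close> fixes the rest.
\<close>

lemma tile_11_exit:
  assumes "gen_adj x y" "sdrop n x = True ## True ## \<zeta>"
  shows "sdrop n y = True ## True ## \<zeta> \<or> sdrop n y = False ## True ## \<zeta>"
proof -
  have fwd: "gen_act t (True ## True ## \<zeta>) \<in> {True ## True ## \<zeta>, False ## True ## \<zeta>}" for t
    by (cases t) (auto simp: gen_act_Stream)
  have inv: "gen_act_inv t (True ## True ## \<zeta>) \<in> {True ## True ## \<zeta>, False ## True ## \<zeta>}" for t
    by (cases t) (subst gen_act_inv.code, simp)+
  from assms(1) obtain s where "y = gen_act s x \<or> x = gen_act s y"
    by (auto simp: gen_adj_def)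
  then show ?thesis
  proof
    assume "y = gen_act s x"
    then show ?thesis using sdrop_gen_act[of n s x] fwd assms(2) by fastforce
  next
    assume "x = gen_act s y"
    then have "sdrop n x = sdrop n y \<or> (\<exists>t. sdrop n y = gen_act_inv t (sdrop n x))"
      using sdrop_gen_act[of n s y] by (metis gen_act_inverse(1))
    then show ?thesis using inv assms(2) by fastforce
  qed
qed

text \<open>
  Any passage of a path through the tile is replaced by a detour inside the one neighbouring tile.
\<close>

lemma tile_11_complement_connected:
  assumes tail: "\<zeta> = True ## True ## \<zeta>'"
    and path: "gen_adj\<^sup>*\<^sup>* x y" and x: "sdrop n x \<noteq> \<zeta>" and y: "sdrop n y \<noteq> \<zeta>"
  shows "(\<lambda>u v. gen_adj u v \<and> sdrop n u \<noteq> \<zeta> \<and> sdrop n v \<noteq> \<zeta>)\<^sup>*\<^sup>* x y"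
proof -
  let ?R = "\<lambda>u v. gen_adj u v \<and> sdrop n u \<noteq> \<zeta> \<and> sdrop n v \<noteq> \<zeta>"
  let ?\<zeta>0 = "False ## True ## \<zeta>'"
  \<comment> \<open>Follow the path. While it is inside the tile, keep a point \<open>p\<close> of the neighbouring tile that is
    reached from outside; wherever the path comes out, it comes out in the same tile as \<open>p\<close>.\<close>
  have "if sdrop n y = \<zeta> then \<exists>p. sdrop n p = ?\<zeta>0 \<and> ?R\<^sup>*\<^sup>* x p else ?R\<^sup>*\<^sup>* x y"
    using path
  proof (induction rule: rtranclp_induct)
    case base
    then show ?case using x by simp
  next
    case (step y z)
    show ?case
    proof (cases "sdrop n y = \<zeta>")
      case False
      show ?thesis
      proof (cases "sdrop n z = \<zeta>")
        case True
        then have "sdrop n y = ?\<zeta>0"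
          using tile_11_exit[OF gen_adj_sym[OF step(2)]] False tail by auto
        then show ?thesis using step.IH False True by auto
      next
        case z: False
        then show ?thesis using step(2) step.IH False
          by (auto intro: rtranclp.rtrancl_into_rtrancl)
      qed
    next
      case True
      with step.IH obtain p where p: "sdrop n p = ?\<zeta>0" "?R\<^sup>*\<^sup>* x p" by auto
      show ?thesis
      proof (cases "sdrop n z = \<zeta>")
        case True
        then show ?thesis using p by auto
      next
        case z: False
        then have "sdrop n z = ?\<zeta>0"
          using tile_11_exit[OF step(2)] True tail by auto
        then have "?R\<^sup>*\<^sup>* p z"
          by (intro rtranclp_mono[THEN predicate2D, OF _ tile_connected[OF p(1)]])
            (auto simp: tail)
        then show ?thesis using p z by auto
      qed
    qed
  qed
  then show ?thesis using y by simp
qed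

definition recurrent_11 :: "word \<Rightarrow> bool" where
  "recurrent_11 \<xi> \<longleftrightarrow> (\<forall>N. \<exists>n\<ge>N. \<xi> !! n \<and> \<xi> !! Suc n)"

lemma sdrop_11:
  assumes "\<xi> !! n" "\<xi> !! Suc n"
  shows "sdrop n \<xi> = True ## True ## sdrop (Suc (Suc n)) \<xi>"
proof -
  have "sdrop n \<xi> = \<xi> !! n ## sdrop (Suc n) \<xi>" by (rule sdrop_unfold)
  also have "sdrop (Suc n) \<xi> = \<xi> !! Suc n ## sdrop (Suc (Suc n)) \<xi>" by (rule sdrop_unfold)
  finally show ?thesis using assms by (simp only: simp_thms)
qed

text \<open>
  Tails agree after any later position of the block 11, since an edge between tiles changes only the
  first letter of a tail beginning with 11. Without the block this fails: \<open>a\<close> changes every second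
  letter of \<open>000\<dots>\<close>.
\<close>

lemma orbit_cofinal:
  assumes "recurrent_11 \<xi>" "gen_adj\<^sup>*\<^sup>* \<xi> \<eta>"
  shows "\<exists>m. sdrop m \<eta> = sdrop m \<xi>"
  using assms(2)
proof (induction rule: rtranclp_induct)
  case (step y z)
  then obtain m where m: "sdrop m y = sdrop m \<xi>" by blast
  obtain n where n: "n \<ge> m" "\<xi> !! n" "\<xi> !! Suc n"
    using assms(1) by (auto simp: recurrent_11_def)
  have "sdrop n y = True ## True ## sdrop (Suc (Suc n)) \<xi>"
    using sdrop_eq_mono[OF m n(1)] sdrop_11[OF n(2,3)] by simp
  from tile_11_exit[OF step(2) this] sdrop_11[OF n(2,3)]
  have "sdrop (Suc n) z = sdrop (Suc n) \<xi>"
    by (metis sdrop_Suc_eq)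
  then show ?case by blast
qed blast

text \<open>
  Any finite set of vertices lies in a tile of \<open>\<xi>\<close> at some later position of the block 11, and such a
  tile is the finite set with connected complement that one-endedness asks for.
\<close>

lemma one_ended_schreier_graph:
  assumes rec: "recurrent_11 \<xi>"
  shows "one_ended (schreier_graph \<xi>)"
proof -
  let ?G = "schreier_graph \<xi>"
  have V: "verts ?G = {\<eta>. gen_adj\<^sup>*\<^sup>* \<xi> \<eta>}"
    by (simp add: schreier_graph_def orbit_basilica)
  have closed: "y \<in> verts ?G" if "x \<in> verts ?G" "gen_adj x y" for x y
    using that by (auto simp: V)
  have cover: "\<exists>n. \<xi> !! n \<and> \<xi> !! Suc n \<and> S \<subseteq> {\<eta>. sdrop n \<eta> = sdrop n \<xi>}"
    if S: "finite S" "S \<subseteq> verts ?G" for S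
  proof -
    have "\<forall>\<eta>\<in>S. \<exists>m. sdrop m \<eta> = sdrop m \<xi>"
      using orbit_cofinal[OF rec] S(2) by (auto simp: V)
    then obtain m where m: "\<And>\<eta>. \<eta> \<in> S \<Longrightarrow> sdrop (m \<eta>) \<eta> = sdrop (m \<eta>) \<xi>" by metis
    obtain n where n: "n \<ge> (\<Sum>\<eta>\<in>S. m \<eta>)" "\<xi> !! n" "\<xi> !! Suc n"
      using rec by (auto simp: recurrent_11_def)
    have "sdrop n \<eta> = sdrop n \<xi>" if "\<eta> \<in> S" for \<eta>
      using sdrop_eq_mono[OF m[OF that]] member_le_sum[of \<eta> S m] that S(1) n(1) by fastforce
    then show ?thesis using n by blast
  qed
  have tile: "\<eta> \<in> verts ?G" if "sdrop n \<eta> = sdrop n \<xi>" for n \<eta>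
  proof -
    have "gen_adj\<^sup>*\<^sup>* \<xi> \<eta>"
      by (rule rtranclp_mono[THEN predicate2D, OF _ tile_connected[OF refl that]]) auto
    then show ?thesis by (simp add: V)
  qed
  have inf: "infinite (verts ?G)"
  proof
    assume "finite (verts ?G)"
    from cover[OF this] obtain n where n: "\<xi> !! n" "verts ?G \<subseteq> {\<eta>. sdrop n \<eta> = sdrop n \<xi>}"
      by blast
    \<comment> \<open>Changing the letter at position \<open>n\<close> leaves this tile but stays in the tile of level \<open>n + 1\<close>,
      which belongs to the orbit.\<close>
    let ?\<eta> = "stake n \<xi> @- (False ## sdrop (Suc n) \<xi>)"
    have drop: "sdrop n ?\<eta> = False ## sdrop (Suc n) \<xi>"
      by (simp add: sdrop_shift)
    then have "sdrop (Suc n) ?\<eta> = sdrop (Suc n) \<xi>" 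
      by (rule sdrop_Suc_eq)
    then have "sdrop n ?\<eta> = sdrop n \<xi>" using tile n(2) by blast
    then have "\<not> \<xi> !! n" using drop by (metis sdrop_simps(1) stream.sel(1))
    with n(1) show False by blast
  qed
  have "\<exists>r. ray ?G r"
  proof (rule exists_ray[OF inf])
    show "\<xi> \<in> verts ?G" by (simp add: V)
    show "y \<in> verts ?G" if "x \<in> verts ?G" "adjacent ?G x y" for x y
      using that closed by (simp add: adjacent_schreier_graph)
    show "finite {y. adjacent ?G x y}" if "x \<in> verts ?G" for x
      using that finite_gen_adj by (simp add: adjacent_schreier_graph)
    fix y assume "y \<in> verts ?G"
    then have "gen_adj\<^sup>*\<^sup>* \<xi> y" by (simp add: V)
    then show "(adjacent ?G)\<^sup>*\<^sup>* \<xi> y"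
    proof (induction rule: rtranclp_induct)
      case (step y z)
      then have "adjacent ?G y z" by (simp add: adjacent_schreier_graph V)
      with step.IH show ?case by (rule rtranclp.rtrancl_into_rtrancl)
    qed simp
  qed
  then show ?thesis
  proof (rule one_endedI)
    fix S assume "finite S" "S \<subseteq> verts ?G"
    then obtain n where n: "\<xi> !! n" "\<xi> !! Suc n" "S \<subseteq> {\<eta>. sdrop n \<eta> = sdrop n \<xi>}"
      using cover by blast
    let ?F = "{\<eta>. sdrop n \<eta> = sdrop n \<xi>}"
    let ?R = "\<lambda>u v. gen_adj u v \<and> sdrop n u \<noteq> sdrop n \<xi> \<and> sdrop n v \<noteq> sdrop n \<xi>"
    let ?R' = "\<lambda>u v. adjacent ?G u v \<and> u \<notin> ?F \<and> v \<notin> ?F"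
    have "?R'\<^sup>*\<^sup>* x y" if x: "x \<in> verts ?G - ?F" and y: "y \<in> verts ?G - ?F" for x y
    proof -
      have "gen_adj\<^sup>*\<^sup>* x \<xi>"
        using x sympD[OF symp_rtranclp[of gen_adj]] gen_adj_sym by (auto simp: V symp_def)
      then have "gen_adj\<^sup>*\<^sup>* x y" using y by (auto simp: V)
      then have "?R\<^sup>*\<^sup>* x y"
        using tile_11_complement_connected[OF sdrop_11[OF n(1,2)]] x y by auto
      then have "y \<in> verts ?G \<and> ?R'\<^sup>*\<^sup>* x y"
      proof (induction rule: rtranclp_induct)
        case (step y z)
        then have yz: "?R' y z" by (simp add: adjacent_schreier_graph)
        from step.IH yz have "?R'\<^sup>*\<^sup>* x z" by (blast intro: rtranclp.rtrancl_into_rtrancl[of ?R'])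
        with step closed show ?case by blast
      qed (use x in auto)
      then show ?thesis ..
    qed
    then show "\<exists>F. finite F \<and> S \<subseteq> F \<and>
      (\<forall>x\<in>verts ?G - F. \<forall>y\<in>verts ?G - F. (\<lambda>u v. adjacent ?G u v \<and> u \<notin> F \<and> v \<notin> F)\<^sup>*\<^sup>* x y)"
      using n(3) finite_tile by (intro exI[of _ ?F]) blast
  qed
qed

section \<open>The block 11 recurs almost surely\<close>

text \<open>
  Splitting off the first two letters shows that the probability \<open>p\<close> of no block 11 at an even
  position satisfies \<open>p = 3/4 p\<close>, so \<open>p = 0\<close>. Deleting an initial segment does not change the
  distribution, which gives a block beyond any given position.
\<close>

lemma AE_recurrent_11: "AE \<xi> in uniform_measure_words. recurrent_11 \<xi>"
proof -
  let ?p = "measure_pmf (bernoulli_pmf (1/2))"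
  interpret S: prob_space "stream_space ?p" by (rule prob_space.prob_space_stream_space[OF prob_space_measure_pmf])
  \<comment> \<open>\<open>A\<close> forbids the block only at even positions, so that disjoint pairs of letters are tested.\<close>
  define A where "A = {\<xi> :: word. \<forall>i. \<not> (\<xi> !! (2 * i) \<and> \<xi> !! Suc (2 * i))}"
  define P where "P N \<xi> \<longleftrightarrow> (\<exists>n\<ge>N. \<xi> !! n \<and> \<xi> !! Suc n)" for N and \<xi> :: word
  have meas: "Measurable.pred (stream_space ?p) (\<lambda>\<xi>. \<xi> !! n)" for n
    by measurable
  note [measurable] = meas
  have A[measurable]: "A \<in> sets (stream_space ?p)"
  proof -
    have "Measurable.pred (stream_space ?p) (\<lambda>\<xi>. \<forall>i. \<not> (\<xi> !! (2 * i) \<and> \<xi> !! Suc (2 * i)))"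
      by measurable
    then show ?thesis by (simp add: A_def pred_def space_stream_space)
  qed
  have A_cons: "x ## y ## \<xi> \<in> A \<longleftrightarrow> \<not> (x \<and> y) \<and> \<xi> \<in> A" for x y \<xi>
  proof -
    have "(\<forall>i. Q i) \<longleftrightarrow> Q 0 \<and> (\<forall>i. Q (Suc i))" for Q :: "nat \<Rightarrow> bool"
      by (metis not0_implies_Suc)
    from this[of "\<lambda>i. \<not> ((x ## y ## \<xi>) !! (2 * i) \<and> (x ## y ## \<xi>) !! Suc (2 * i))"]
    show ?thesis by (simp add: A_def)
  qed
  let ?e = "emeasure (stream_space ?p) A"
  have A_cons1: "{\<xi>. x ## \<xi> \<in> A} \<in> sets (stream_space ?p)" for x
  proof -
    have "(\<lambda>\<xi>. x ## \<xi>) -` A \<inter> space (stream_space ?p) \<in> sets (stream_space ?p)"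
      by measurable
    then show ?thesis by (simp add: vimage_def space_stream_space)
  qed
  have two: "emeasure (stream_space ?p) {\<xi>. x ## y ## \<xi> \<in> A} = (if x \<and> y then 0 else ?e)" for x y
    by (auto simp: A_cons)
  have one: "emeasure (stream_space ?p) {\<xi>. x ## \<xi> \<in> A} =
      (\<integral>\<^sup>+y. emeasure (stream_space ?p) {\<xi>. x ## y ## \<xi> \<in> A} \<partial>?p)" for x
    using prob_space.emeasure_stream_space[OF prob_space_measure_pmf, OF A_cons1[of x]] by (simp add: space_stream_space)
  have "?e = (\<integral>\<^sup>+x. (\<integral>\<^sup>+y. (if x \<and> y then 0 else ?e) \<partial>?p) \<partial>?p)"
    using prob_space.emeasure_stream_space[OF prob_space_measure_pmf, OF A] by (simp add: space_stream_space one two)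
  also have "\<dots> = ennreal (3/4 * S.prob A)"
  proof -
    have "ennreal r * inverse 2 = ennreal (r / 2)" if "0 \<le> r" for r
      using ennreal_divide_numeral[OF that, of "num.Bit0 num.One"] by (simp add: divide_ennreal_def)
    then show ?thesis
      by (simp add: S.emeasure_eq_measure ennreal_plus[symmetric] del: ennreal_plus)
  qed
  finally have "?e = 0"
    by (simp add: S.emeasure_eq_measure ennreal_mult[symmetric])
  then have "AE \<xi> in stream_space ?p. \<xi> \<notin> A"
    by (intro AE_not_in null_setsI A)
  then have "AE \<xi> in stream_space ?p. P 0 \<xi>"
    by eventually_elim (auto simp: A_def P_def)
  then have P: "AE \<xi> in stream_space ?p. P N \<xi>" for N
  proof (induction N)
    case (Suc N)
    have "P (Suc N) (x ## \<xi>)" if "P N \<xi>" for x \<xi>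
      using that unfolding P_def by (metis Suc_le_mono snth_Stream)
    then have "AE x in ?p. AE \<xi> in stream_space ?p. P (Suc N) (x ## \<xi>)"
      using Suc by (auto elim: AE_mp)
    moreover have "Measurable.pred (stream_space ?p) (P (Suc N))"
      unfolding P_def by measurable
    ultimately show ?case
      using prob_space.AE_stream_space[OF prob_space_measure_pmf] by blast
  qed
  have "AE \<xi> in stream_space ?p. \<forall>N. P N \<xi>"
    using P by (simp add: AE_all_countable)
  then show ?thesis
    unfolding uniform_measure_words_def recurrent_11_def P_def .
qed

theorem proposition5p11:
  shows "(AE \<xi> in uniform_measure_words. one_ended (schreier_graph \<xi>)) \<and>
    (AE (\<Gamma>, \<xi>) in uniform_measure_rooted. one_ended \<Gamma>)"
proof -
  have ae: "AE \<xi> in uniform_measure_words. one_ended (schreier_graph \<xi>)"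
    using AE_recurrent_11 by eventually_elim (rule one_ended_schreier_graph)
  moreover have "inj (\<lambda>\<xi>. (schreier_graph \<xi>, \<xi>))" by (auto intro: injI)
  ultimately show ?thesis
    unfolding uniform_measure_rooted_def by (simp add: AE_embed_measure)
qed

end
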